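(* The following assertion is false for $n=5$: "for all upward closed set systems $X,Y,Z\subset Q_n$ of equal density $\rho=|X|/2^n=|Y|/2^n=|Z|/2^n$, one has $\frac{|S_1|}{2^n}\le 3\rho(1-\rho)^2$", where $S_1=(X\cap Y^c\cap Z^c)\sqcup (X^c\cap Y\cap Z^c)\sqcup (X^c\cap Y^c\cap Z)$ is the set of points of $Q_n$ lying in exactly one of $X,Y,Z$. That is, there exist upward closed set systems $X,Y,Z\subset Q_5$ with $|X|=|Y|=|Z|=\rho\cdot 2^5$ for some $\rho$, such that $$\frac{|S_1|}{2^5}> 3\rho(1-\rho)^2.$$
   Context: $Q_n$ denotes the power set of $[n]=\{1,2,\dots,n\}$, ordered by inclusion. A set system $X\subset Q_n$ is upward closed if whenever $A\in X$ and $A\subset B\subset [n]$, also $B\in X$. Complements are taken in $Q_n$. *)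

theory Defs
  imports Complex_Main
begin

definition Q :: "nat \<Rightarrow> nat set set" where
  "Q n = Pow {1..n}"

definition upward_closed :: "nat \<Rightarrow> nat set set \<Rightarrow> bool" where
  "upward_closed n X \<longleftrightarrow>
     X \<subseteq> Q n \<and> (\<forall>A B. A \<in> X \<longrightarrow> A \<subseteq> B \<longrightarrow> B \<subseteq> {1..n} \<longrightarrow> B \<in> X)"

definition compl_in :: "nat \<Rightarrow> nat set set \<Rightarrow> nat set set" where
  "compl_in n X = Q n - X"

definition S1 :: "nat \<Rightarrow> nat set set \<Rightarrow> nat set set \<Rightarrow> nat set set \<Rightarrow> nat set set" where
  "S1 n X Y Z =
     (X \<inter> compl_in n Y \<inter> compl_in n Z)
   \<union> (compl_in n X \<inter> Y \<inter> compl_in n Z)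
   \<union> (compl_in n X \<inter> compl_in n Y \<inter> Z)"

end

theory Submission
  imports Defs
begin

text \<open>
  If \<open>X\<close>, \<open>Y\<close>, \<open>Z\<close> are independent and their complements have density \<open>\<tau> = 1 - \<rho>\<close>, a point lies in
  exactly one of them with probability \<open>3 (1 - \<tau>) \<tau>\<^sup>2\<close>, which is of order \<open>\<tau>\<^sup>2\<close>. Taking \<open>X = Y\<close>
  makes this probability of order \<open>\<tau>\<close>: every point of \<open>Z - X\<close> then lies in exactly one of the
  three systems. So it suffices to have two different up-sets whose complements are equally large
  and very small.
  The complements \<open>{{}, {1}}\<close> of \<open>X = Y\<close> and \<open>{{}, {2}}\<close> of \<open>Z\<close> have density \<open>\<tau> = 1/16\<close>, and the
  point \<open>{1}\<close> lies in \<open>Z\<close> only. Hence \<open>S1\<close> has density \<open>1/32 = 128/4096\<close>, whereas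
  \<open>3 \<rho> (1 - \<rho>)\<^sup>2 = 45/4096\<close>.
\<close>

lemma upward_closed_not_subset: "upward_closed n (Q n - Pow S)"
  unfolding upward_closed_def Q_def by auto

lemma card_not_subset:
  assumes "S \<subseteq> {1..n}"
  shows "card (Q n - Pow S) = 2 ^ n - 2 ^ card S"
proof -
  have "finite S" using assms by (rule finite_subset) simp
  moreover have "Pow S \<subseteq> Q n" using assms unfolding Q_def by auto
  ultimately show ?thesis
    by (simp add: card_Diff_subset Q_def card_Pow)
qed

lemma S1_same:
  assumes "X \<subseteq> Q n" and "Z \<subseteq> Q n"
  shows "S1 n X X Z = Z - X"
  using assms unfolding S1_def compl_in_def by auto

theorem mainTheorem3:
  shows "\<exists>(X :: nat set set) (Y :: nat set set) (Z :: nat set set) (\<rho> :: real).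
           upward_closed 5 X \<and> upward_closed 5 Y \<and> upward_closed 5 Z \<and>
           real (card X) / 2 ^ 5 = \<rho> \<and>
           real (card Y) / 2 ^ 5 = \<rho> \<and>
           real (card Z) / 2 ^ 5 = \<rho> \<and>
           real (card (S1 5 X Y Z)) / 2 ^ 5 > 3 * \<rho> * (1 - \<rho>)\<^sup>2"
proof -
  define X :: "nat set set" where "X = Q 5 - Pow {1}"
  define Z :: "nat set set" where "Z = Q 5 - Pow {2}"
  have up: "upward_closed 5 X" "upward_closed 5 Z"
    unfolding X_def Z_def by (rule upward_closed_not_subset)+
  have card: "card X = 30" "card Z = 30"
    unfolding X_def Z_def by (simp_all add: card_not_subset)
  have "S1 5 X X Z = Z - X"
    by (rule S1_same) (auto simp: X_def Z_def)
  also have "Z - X = {{1}}"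
    unfolding X_def Z_def Q_def by (auto simp: subset_singleton_iff)
  finally have "card (S1 5 X X Z) = 1" by simp
  then have "3 * (30 / 2 ^ 5) * (1 - 30 / 2 ^ 5)\<^sup>2 < real (card (S1 5 X X Z)) / 2 ^ 5"
    by (simp add: power2_eq_square)
  then show ?thesis
    using up card by (intro exI[of _ X] exI[of _ Z] exI[of _ "30 / 2 ^ 5 :: real"]) simp
qed

end
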